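(* For every positive integer $n$, the Randić energy of the Dutch windmill graph $D_5^n$ is $RE(D_5^n)=1+n\sqrt5$.
   Context: For a graph $G$ with vertices $v_1,\dots,v_N$ of degrees $d_1,\dots,d_N$, the Randić matrix $R(G)$ has $(i,j)$-entry $1/\sqrt{d_id_j}$ if $v_i\sim v_j$ and $0$ otherwise; the Randić energy $RE(G)$ is the sum of the absolute values of the eigenvalues of $R(G)$. The Dutch windmill graph $D_5^n$ is the graph with $4n+1$ vertices obtained from $n$ disjoint copies of the $5$-cycle $C_5$ by identifying one vertex from each copy into a single common vertex. *)

theory Defs
  imports
    Complex_Main
    "Jordan_Normal_Form.Char_Poly"
    "Graph_Theory.Pair_Digraph"
begin

text \<open>
  A finite simple graph is a \<^locale>\<open>pair_graph\<close>: every edge \<open>{u, v}\<close> is represented by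
  the two arcs \<open>(u, v)\<close> and \<open>(v, u)\<close>, so the degree of a vertex is its \<^const>\<open>out_degree\<close>.
\<close>

text \<open>The list \<open>vs\<close> is the enumeration of the vertices that indexes the rows and columns.\<close>

definition randic_matrix :: "'a pair_pre_digraph \<Rightarrow> 'a list \<Rightarrow> real mat" where
  "randic_matrix G vs = mat (length vs) (length vs) (\<lambda>(i, j).
     if vs ! i \<rightarrow>\<^bsub>with_proj G\<^esub> vs ! j
     then 1 / sqrt (real (out_degree G (vs ! i)) * real (out_degree G (vs ! j)))
     else 0)"

text \<open>
  The eigenvalues are the roots of the characteristic polynomial, counted with multiplicity.
  The matrix is real symmetric, so all of its eigenvalues are real.
\<close>

definition randic_energy :: "'a pair_pre_digraph \<Rightarrow> 'a list \<Rightarrow> real" where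
  "randic_energy G vs = (\<Sum>x\<in>#proots (char_poly (randic_matrix G vs)). \<bar>x\<bar>)"

text \<open>This is the cycle of length \<open>m\<close> only for \<open>m \<ge> 3\<close>.\<close>

definition cycle_graph :: "nat \<Rightarrow> nat pair_pre_digraph" where
  "cycle_graph m =
     \<lparr>pverts = {..<m},
      parcs = {(i, j). i < m \<and> j < m \<and> (j = Suc i mod m \<or> i = Suc j mod m)}\<rparr>"

definition disjoint_copies :: "nat \<Rightarrow> 'a pair_pre_digraph \<Rightarrow> (nat \<times> 'a) pair_pre_digraph" where
  "disjoint_copies n G =
     \<lparr>pverts = {..<n} \<times> pverts G,
      parcs = {((k, u), (k, v)) | k u v. k < n \<and> (u, v) \<in> parcs G}\<rparr>"

text \<open>The graph obtained by identifying vertices with the same image under \<open>f\<close>;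
  parallel edges that this creates are merged.\<close>

definition identify_verts :: "('a \<Rightarrow> 'b) \<Rightarrow> 'a pair_pre_digraph \<Rightarrow> 'b pair_pre_digraph" where
  "identify_verts f G = \<lparr>pverts = f ` pverts G, parcs = map_prod f f ` parcs G\<rparr>"

text \<open>\<open>dutch_windmill m n\<close> is the graph \<open>D\<^sub>m\<^sup>n\<close>; the common vertex is \<open>(0, 0)\<close>.\<close>

definition dutch_windmill :: "nat \<Rightarrow> nat \<Rightarrow> (nat \<times> nat) pair_pre_digraph" where
  "dutch_windmill m n =
     identify_verts (\<lambda>(k, v). if v = 0 then (0, 0) else (k, v)) (disjoint_copies n (cycle_graph m))"

lemma pverts_dutch_windmill:
  assumes "m > 0" "n > 0"
  shows "pverts (dutch_windmill m n) = insert (0, 0) ({..<n} \<times> {1..<m})"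
proof -
  define f :: "nat \<times> nat \<Rightarrow> nat \<times> nat"
    where "f = (\<lambda>(k, v). if v = 0 then (0, 0) else (k, v))"
  have V: "pverts (dutch_windmill m n) = f ` ({..<n} \<times> {..<m})"
    by (simp add: dutch_windmill_def identify_verts_def disjoint_copies_def cycle_graph_def f_def)
  have "f p \<in> insert (0, 0) ({..<n} \<times> {1..<m})" if "p \<in> {..<n} \<times> {..<m}" for p
    using that by (auto simp: f_def split: if_splits)
  moreover have "(0, 0) = f (0, 0)" "(0, 0) \<in> {..<n} \<times> {..<m}"
    using assms by (auto simp: f_def)
  moreover have "p = f p \<and> p \<in> {..<n} \<times> {..<m}" if "p \<in> {..<n} \<times> {1..<m}" for p
    using that by (auto simp: f_def)
  ultimately show ?thesis
    unfolding V by blast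
qed

lemma card_pverts_dutch_windmill:
  assumes "m > 0" "n > 0"
  shows "card (pverts (dutch_windmill m n)) = (m - 1) * n + 1"
  using assms by (simp add: pverts_dutch_windmill card_insert_if)

lemma pair_graph_dutch_windmill:
  assumes "m \<ge> 3"
  shows "pair_graph (dutch_windmill m n)"
proof -
  define f :: "nat \<times> nat \<Rightarrow> nat \<times> nat"
    where "f = (\<lambda>(k, v). if v = 0 then (0, 0) else (k, v))"
  let ?C = "cycle_graph m" and ?D = "dutch_windmill m n"
  have D: "?D = identify_verts f (disjoint_copies n ?C)"
    by (simp add: dutch_windmill_def f_def)
  have V: "pverts ?D = f ` ({..<n} \<times> pverts ?C)"
    by (simp add: D identify_verts_def disjoint_copies_def)
  have A: "parcs ?D = {(f (k, u), f (k, v)) | k u v. k < n \<and> (u, v) \<in> parcs ?C}"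
  proof -
    have "map_prod f f ` {((k, u), (k, v)) | k u v. P k u v} = {(f (k, u), f (k, v)) | k u v. P k u v}"
      for f :: "nat \<times> nat \<Rightarrow> nat \<times> nat" and P by (force simp: image_iff)
    thus ?thesis
      unfolding D identify_verts_def disjoint_copies_def pair_pre_digraph.simps .
  qed
  have C: "u < m \<and> v < m \<and> u \<noteq> v \<and> (v, u) \<in> parcs ?C" if "(u, v) \<in> parcs ?C" for u v
    using that assms by (auto simp: cycle_graph_def mod_Suc split: if_splits)
  have fin: "finite (pverts ?D)"
    unfolding V by (intro finite_imageI finite_cartesian_product) (auto simp: cycle_graph_def)
  have arc: "fst e \<in> pverts ?D \<and> snd e \<in> pverts ?D \<and> fst e \<noteq> snd e \<and> (snd e, fst e) \<in> parcs ?D"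
    if e_in: "e \<in> parcs ?D" for e
  proof -
    obtain k u v where e: "e = (f (k, u), f (k, v))" "k < n" "(u, v) \<in> parcs ?C"
      using e_in unfolding A by blast
    note c = C[OF e(3)]
    have "(k, u) \<in> {..<n} \<times> pverts ?C" "(k, v) \<in> {..<n} \<times> pverts ?C"
      using c e(2) by (auto simp: cycle_graph_def)
    hence "fst e \<in> pverts ?D" "snd e \<in> pverts ?D"
      unfolding V e(1) fst_conv snd_conv by blast+
    moreover have "fst e \<noteq> snd e"
      using c unfolding e(1) f_def by auto
    moreover have "(snd e, fst e) \<in> parcs ?D"
      unfolding A e(1) fst_conv snd_conv using c e(2) by blast
    ultimately show ?thesis by blast
  qed
  have "parcs ?D \<subseteq> pverts ?D \<times> pverts ?D"
    using arc by (metis mem_Sigma_iff prod.collapse subrelI fst_conv snd_conv)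
  hence "finite (parcs ?D)"
    using fin by (meson finite_SigmaI finite_subset)
  moreover have "symmetric (with_proj ?D)"
    unfolding symmetric_def with_proj_simps by (rule symI) (use arc in fastforce)
  ultimately show ?thesis
    using fin arc by unfold_locales blast+
qed

end

theory Submission
  imports Defs "HOL-Combinatorics.Permutations"
begin

text \<open>
  For a real number \<open>x > 2\<close>, the determinant of \<open>x I - R\<close> is computed by Gaussian elimination.
  Removing the four rim vertices of one cycle contributes the factor
  \<open>(x\<^sup>2 - x/2 - 1/4) (x\<^sup>2 + x/2 - 1/4)\<close> and changes no other entry than the diagonal entry of the
  common vertex, which drops by \<open>(x - 1/2) / (2 n (x\<^sup>2 - x/2 - 1/4))\<close>. After all \<open>n\<close> cycles the
  total drop is independent of \<open>n\<close>, and the characteristic polynomial becomes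
  \<open>(x - 1) (x\<^sup>2 + x/2 - 1/4)\<^sup>2 ((x\<^sup>2 - x/2 - 1/4) (x\<^sup>2 + x/2 - 1/4))\<^bsup>n-1\<^esup>\<close>.
  The roots of each quadratic factor have absolute values adding up to \<open>\<surd>5 / 2\<close>.
\<close>

section \<open>Determinants of matrices indexed by lists of vertices\<close>

definition list_mat :: "('a \<Rightarrow> 'a \<Rightarrow> 'b) \<Rightarrow> 'a list \<Rightarrow> 'b mat" where
  "list_mat f vs = mat (length vs) (length vs) (\<lambda>(i, j). f (vs ! i) (vs ! j))"

lemma list_mat_carrier [simp]: "list_mat f vs \<in> carrier_mat (length vs) (length vs)"
  by (simp add: list_mat_def)

lemma list_mat_cong:
  assumes "\<And>u v. u \<in> set vs \<Longrightarrow> v \<in> set vs \<Longrightarrow> f u v = g u v"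
  shows "list_mat f vs = list_mat g vs"
  using assms by (intro eq_matI) (auto simp: list_mat_def)

text \<open>The same permutation acts on rows and on columns, so its sign enters twice and squares
  to 1. Hence any enumeration of the vertices may be replaced by one that suits the
  elimination.\<close>

lemma det_list_mat_perm:
  fixes f :: "'a \<Rightarrow> 'a \<Rightarrow> 'b :: comm_ring_1"
  assumes "mset vs = mset ws"
  shows "det (list_mat f vs) = det (list_mat f ws)"
proof -
  obtain p where p: "p permutes {..<length ws}" "permute_list p ws = vs"
    using mset_eq_permutation[OF assms] .
  let ?n = "length ws" and ?A = "list_mat f ws"
  let ?B = "mat ?n ?n (\<lambda>(i, j). ?A $$ (p i, j))"
  have p': "p permutes {0..<?n}" using p(1) by (simp add: atLeast0LessThan)
  have plt: "p i < ?n \<longleftrightarrow> i < ?n" for i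
    using permutes_in_image[OF p(1)] by simp
  \<comment> \<open>Both permutations are carried out on rows; transposing in between turns the
    second one into the permutation of the columns.\<close>
  have "list_mat f vs = transpose_mat (mat ?n ?n (\<lambda>(i, j). transpose_mat ?B $$ (p i, j)))"
    using p plt by (intro eq_matI) (auto simp: list_mat_def permute_list_nth p(2)[symmetric])
  also have "det \<dots> = det (mat ?n ?n (\<lambda>(i, j). transpose_mat ?B $$ (p i, j)))"
    by (rule det_transpose) auto
  also have "\<dots> = signof p * det (transpose_mat ?B)"
    by (rule det_permute_rows[OF _ p']) auto
  also have "det (transpose_mat ?B) = det ?B"
    by (rule det_transpose) auto
  also have "\<dots> = signof p * det ?A"
    by (rule det_permute_rows[OF _ p']) auto
  also have "signof p * (signof p * det ?A) = det ?A"
    by (simp add: sign_def)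
  finally show ?thesis .
qed

definition schur_complement :: "'a \<Rightarrow> ('a \<Rightarrow> 'a \<Rightarrow> 'b) \<Rightarrow> 'a \<Rightarrow> 'a \<Rightarrow> 'b :: field" where
  "schur_complement v f = (\<lambda>u w. f u w - f u v * f v w / f v v)"

text \<open>One step of block LU factorization with pivot \<open>f v v\<close>: \<open>?L\<close> is
  unitriangular and \<open>?U\<close> is block upper triangular. The remaining matrix is again given
  by a function of vertices, so the step can be iterated along the list.\<close>

lemma det_list_mat_Cons:
  fixes f :: "'a \<Rightarrow> 'a \<Rightarrow> 'b :: field"
  assumes "f v v \<noteq> 0"
  shows "det (list_mat f (v # vs)) = f v v * det (list_mat (schur_complement v f) vs)"
proof -
  let ?n = "length vs"
  let ?L = "four_block_mat (1\<^sub>m 1) (0\<^sub>m 1 ?n) (mat ?n 1 (\<lambda>(i, j). f (vs ! i) v / f v v)) (1\<^sub>m ?n)"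
  let ?U = "four_block_mat (mat 1 1 (\<lambda>_. f v v)) (mat 1 ?n (\<lambda>(i, j). f v (vs ! j)))
     (0\<^sub>m ?n 1) (list_mat (schur_complement v f) vs)"
  have "list_mat f (v # vs) = ?L * ?U"
    using assms
    by (subst mult_four_block_mat[where ?nr1.0 = 1 and ?nr2.0 = ?n and ?n1.0 = 1 and ?n2.0 = ?n
          and ?nc1.0 = 1 and ?nc2.0 = ?n])
      (auto intro!: eq_matI simp: list_mat_def schur_complement_def scalar_prod_def nth_Cons' Suc_diff_le)
  moreover have "det ?L = 1"
    by (subst det_four_block_mat_upper_right_zero[of _ 1 _ ?n]) auto
  moreover have "det ?U = f v v * det (list_mat (schur_complement v f) vs)"
    by (subst det_four_block_mat_lower_left_zero[of _ 1 _ ?n]) (auto simp: det_single)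
  moreover have "det (?L * ?U) = det ?L * det ?U"
    by (rule det_mult[of _ "1 + ?n"]; rule four_block_carrier_mat) auto
  ultimately show ?thesis by simp
qed

lemma poly_char_poly_list_mat:
  fixes f :: "'a \<Rightarrow> 'a \<Rightarrow> 'b :: field"
  assumes "distinct vs"
  shows "poly (char_poly (list_mat f vs)) x
    = det (list_mat (\<lambda>u v. (if u = v then x else 0) - f u v) vs)"
  unfolding char_poly_def
  by (rule poly_det_cong[of _ "length vs"])
    (use assms in \<open>auto simp: char_poly_matrix_def list_mat_def nth_eq_iff_index_eq\<close>)

section \<open>Elimination of one cycle\<close>

text \<open>Here \<open>a\<close>, \<open>b\<close>, \<open>c\<close>, \<open>d\<close> form the rim
  path of one cycle and \<open>h\<close> is the hub. The reflection of the path splits its block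
  into a symmetric part of determinant \<open>x^2 - x/2 - 1/4\<close> and an antisymmetric part of
  determinant \<open>x^2 + x/2 - 1/4\<close>. The coupling to \<open>h\<close> is symmetric, so only
  the first determinant occurs in the denominator of the correction.\<close>

lemma det_list_mat_ear:
  fixes f :: "'a \<Rightarrow> 'a \<Rightarrow> real"
  assumes x: "x > 2"
    and diag: "f a a = x" "f b b = x" "f c c = x" "f d d = x"
    and path: "f a b = -1/2" "f b a = -1/2" "f b c = -1/2" "f c b = -1/2"
      "f c d = -1/2" "f d c = -1/2"
    and non: "f a c = 0" "f c a = 0" "f a d = 0" "f d a = 0" "f b d = 0" "f d b = 0"
    and hub: "f a h = -g" "f h a = -g" "f d h = -g" "f h d = -g"
      "f b h = 0" "f h b = 0" "f c h = 0" "f h c = 0"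
    and rest: "\<And>u v. u \<in> {a, b, c, d} \<Longrightarrow> v \<in> set xs \<Longrightarrow> v \<noteq> h \<Longrightarrow> f u v = 0 \<and> f v u = 0"
  shows "det (list_mat f (a # b # c # d # xs)) =
    (x^2 - x/2 - 1/4) * (x^2 + x/2 - 1/4) *
    det (list_mat (\<lambda>u v. f u v -
      (if u = h \<and> v = h then 2 * g^2 * (x - 1/2) / (x^2 - x/2 - 1/4) else 0)) xs)"
proof -
  \<comment> \<open>\<open>x\<close>, \<open>?D2\<close>, \<open>?D3\<close> and
    \<open>?q * ?q'\<close> are the leading principal minors of the path block; the four pivots are
    their successive quotients, nonzero for \<open>x > 2\<close>.\<close>
  let ?D2 = "x^2 - 1/4" and ?D3 = "x^3 - x/2"
  let ?q = "x^2 - x/2 - 1/4" and ?q' = "x^2 + x/2 - 1/4"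
  have xx: "x^2 > 2 * x" using x by (simp add: power2_eq_square)
  moreover have "x^3 = x * x^2" by (simp add: power2_eq_square power3_eq_cube)
  moreover have "x * x^2 > x * 1"
    using x xx by (intro mult_strict_left_mono) linarith+
  ultimately have nz: "x \<noteq> 0" "?D2 \<noteq> 0" "?D3 \<noteq> 0" "?q \<noteq> 0" "?q' \<noteq> 0"
    using x by linarith+
  define f1 where "f1 = schur_complement a f"
  define f2 where "f2 = schur_complement b f1"
  define f3 where "f3 = schur_complement c f2"
  define f4 where "f4 = schur_complement d f3"
  note s1 = f1_def schur_complement_def diag path non hub
  have v1: "f1 b b = ?D2 / x" "f1 c c = x" "f1 d d = x" "f1 b c = -1/2" "f1 c b = -1/2"
    "f1 c d = -1/2" "f1 d c = -1/2" "f1 b d = 0" "f1 d b = 0"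
    "f1 b h = -g/(2*x)" "f1 h b = -g/(2*x)" "f1 c h = 0" "f1 h c = 0" "f1 d h = -g" "f1 h d = -g"
    "f1 h h = f h h - g^2/x"
    using nz by (simp_all add: s1 field_simps power2_eq_square)
  note s2 = f2_def schur_complement_def v1
  have v2: "f2 c c = ?D3 / ?D2" "f2 d d = x" "f2 c d = -1/2" "f2 d c = -1/2"
    "f2 c h = -g/(4*?D2)" "f2 h c = -g/(4*?D2)" "f2 d h = -g" "f2 h d = -g"
    "f2 h h = f h h - g^2/x - g^2/(4*x*?D2)"
    using nz by (simp_all add: s2 divide_simps) (simp_all add: algebra_simps power2_eq_square power3_eq_cube)
  note s3 = f3_def schur_complement_def v2
  have v3: "f3 d d = ?q * ?q' / ?D3" "f3 d h = -g - g/(8*?D3)" "f3 h d = -g - g/(8*?D3)"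
    "f3 h h = f h h - g^2/x - g^2/(4*x*?D2) - g^2/(16*?D2*?D3)"
    using nz by (simp_all add: s3 divide_simps) (simp_all add: algebra_simps power2_eq_square power3_eq_cube)
  have v4: "f4 h h = f h h - 2 * g^2 * (x - 1/2) / ?q"
  proof -
    \<comment> \<open>The pivots \<open>a\<close>, \<open>b\<close>, \<open>c\<close> together lower
      the entry at \<open>h\<close> by \<open>g^2\<close> times the corner entry of the inverse of
      their 3 by 3 block, which is \<open>?D2 / ?D3\<close> by Cramer's rule.\<close>
    have "1/x + 1/(4*x*?D2) + 1/(16*?D2*?D3) = ?D2 / ?D3"
    proof -
      have common: "x / s + 1/(16*s*t) = (16*x*t + 1) / (16*s*t)" if "s \<noteq> 0" "t \<noteq> 0" for s t :: real
        using that by (simp add: field_simps)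
      have "1/x + 1/(4*x*?D2) = x / ?D2"
        using nz by (simp add: divide_simps) (simp add: algebra_simps power2_eq_square)
      also have "x / ?D2 + 1/(16*?D2*?D3) = (16*x*?D3 + 1) / (16*?D2*?D3)"
        by (rule common[OF nz(2,3)])
      also have "16*x*?D3 + 1 = 16*?D2*?D2"
        by (simp add: power2_eq_square power3_eq_cube algebra_simps)
      also have "16*?D2*?D2 / (16*?D2*?D3) = ?D2 / ?D3"
        using nz by simp
      finally show ?thesis .
    qed
    moreover have "(1 + 1/(8*?D3))^2 * ?D3 / (?q*?q') = (?D3 + 1/8)^2 / (?D3 * (?q*?q'))"
    proof -
      have "1 + 1/(8*?D3) = (?D3 + 1/8) / ?D3"
        using nz(3) by (simp only: add_divide_distrib) simp
      thus ?thesis using nz(3) by (simp add: power2_eq_square)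
    qed
    moreover have "?D2 / ?D3 + (?D3 + 1/8)^2 / (?D3 * (?q*?q')) =
        (?D2*(?q*?q') + (?D3 + 1/8)^2) / (?D3 * (?q*?q'))"
      using nz by (simp only: add_divide_distrib) simp
    \<comment> \<open>This factorization lets \<open>?q'\<close> and \<open>?D3\<close>
      cancel.\<close>
    moreover have "?D2*(?q*?q') + (?D3 + 1/8)^2 = 2*(x - 1/2)*?q'*?D3"
      by (simp add: power2_eq_square power3_eq_cube algebra_simps diff_divide_distrib add_divide_distrib)
    moreover have "2*(x - 1/2)*?q'*?D3 / (?D3 * (?q*?q')) = 2*(x - 1/2)/?q"
      using nz by simp
    ultimately have "1/x + 1/(4*x*?D2) + 1/(16*?D2*?D3) +
        (1 + 1/(8*?D3))^2 * ?D3 / (?q*?q') = 2*(x - 1/2)/?q"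
      by (simp only:)
    hence "g^2 * (1/x + 1/(4*x*?D2) + 1/(16*?D2*?D3) +
        (1 + 1/(8*?D3))^2 * ?D3 / (?q*?q')) = 2* g^2*(x - 1/2)/?q"
      by simp
    moreover have "-g - g/(8*?D3) = - (g * (1 + 1/(8*?D3)))"
      by (simp add: algebra_simps)
    ultimately show ?thesis
      by (simp add: f4_def schur_complement_def v3) (simp add: algebra_simps power2_eq_square)
  qed
  \<comment> \<open>Each correction is a product of an entry from \<open>u\<close> to the pivot and
    one from the pivot to \<open>v\<close>; on \<open>xs\<close> both are nonzero only if
    \<open>u\<close> and \<open>v\<close> are \<open>h\<close>.\<close>
  have f4: "f4 u v = f u v" if "u \<in> set xs" "v \<in> set xs" "\<not> (u = h \<and> v = h)" for u v
  proof -
    have zero: "f s t = 0 \<and> f t s = 0" "f1 s t = 0 \<and> f1 t s = 0" "f2 s t = 0 \<and> f2 t s = 0"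
      "f3 s t = 0 \<and> f3 t s = 0"
      if "s \<in> {a, b, c, d}" "t \<in> set xs" "t \<noteq> h" for s t
      using that rest[of _ t] by (simp_all add: f1_def f2_def f3_def schur_complement_def)
    show ?thesis
      using that zero[of _ u] zero[of _ v]
      by (cases "u = h") (simp_all add: f4_def schur_complement_def f3_def f2_def f1_def)
  qed
  have "det (list_mat f (a # b # c # d # xs)) = f a a * (f1 b b * (f2 c c * (f3 d d * det (list_mat f4 xs))))"
    using nz by (simp add: det_list_mat_Cons diag v1 v2 v3 flip: f1_def f2_def f3_def f4_def)
  also have "list_mat f4 xs = list_mat (\<lambda>u v. f u v - (if u = h \<and> v = h then 2 * g^2 * (x - 1/2) / ?q else 0)) xs"
    by (rule list_mat_cong) (use f4 v4 in auto)
  finally show ?thesis using nz by (simp add: diag v1 v2 v3)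
qed

section \<open>Arcs and degrees of the windmill\<close>

text \<open>The list \<open>c\<close> is the closed walk from the hub around copy \<open>k\<close>,
  and the two zips give its steps in both directions. Adjacency thus becomes membership in explicit
  lists.\<close>

lemma parcs_dutch_windmill:
  "parcs (dutch_windmill 5 n) = (\<Union>k<n. let c = [(0, 0), (k, 1), (k, 2), (k, 3), (k, 4), (0, 0)] in
     set (zip c (tl c)) \<union> set (zip (tl c) c))"
proof -
  have "parcs (cycle_graph 5) = (\<Union>i<5. {(i, Suc i mod 5), (Suc i mod 5, i)})"
    by (auto simp: cycle_graph_def)
  moreover have "{..<5} = {0, 1, 2, 3, 4 :: nat}"
    by auto
  ultimately have "parcs (cycle_graph 5) =
    {(0, 1), (1, 2), (2, 3), (3, 4), (4, 0), (1, 0), (2, 1), (3, 2), (4, 3), (0, 4)}" (is "_ = ?C")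
    by (simp add: numeral_2_eq_2 insert_commute)
  moreover have "parcs (disjoint_copies n G) = (\<Union>k<n. (\<lambda>(u, v). ((k, u), (k, v))) ` parcs G)" for G :: "nat pair_pre_digraph"
    by (auto simp: disjoint_copies_def)
  ultimately have "parcs (disjoint_copies n (cycle_graph 5)) = (\<Union>k<n. (\<lambda>(u, v). ((k, u), (k, v))) ` ?C)"
    by simp
  thus ?thesis
    unfolding dutch_windmill_def identify_verts_def by (simp add: image_UN Let_def insert_commute)
qed

lemma out_degree_with_proj: "out_degree (with_proj G) u = card {v. (u, v) \<in> parcs G}"
proof -
  have "out_arcs (with_proj G) u = Pair u ` {v. (u, v) \<in> parcs G}"
    by (auto simp: out_arcs_def)
  thus ?thesis
    by (simp add: out_degree_def card_image inj_on_def)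
qed

lemma out_degree_windmill_hub:
  "out_degree (with_proj (dutch_windmill 5 n)) (0, 0) = 2 * n"
proof -
  have "{v. ((0, 0), v) \<in> parcs (dutch_windmill 5 n)} = {..<n} \<times> {1, 4}"
    by (auto simp: parcs_dutch_windmill)
  thus ?thesis
    by (simp add: out_degree_with_proj card_cartesian_product)
qed

lemma out_degree_windmill_rim:
  assumes "k < n" "i \<in> {1, 2, 3, 4}"
  shows "out_degree (with_proj (dutch_windmill 5 n)) (k, i) = 2"
proof -
  have "{v. ((k, i), v) \<in> parcs (dutch_windmill 5 n)} =
    (if i = 1 then {(0, 0), (k, 2)} else if i = 4 then {(k, 3), (0, 0)} else {(k, i - 1), (k, i + 1)})"
    using assms by (auto simp: parcs_dutch_windmill)
  thus ?thesis
    using assms by (auto simp: out_degree_with_proj)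
qed

section \<open>The characteristic polynomial\<close>

definition randic_weight :: "'a pair_pre_digraph \<Rightarrow> 'a \<Rightarrow> 'a \<Rightarrow> real" where
  "randic_weight G u v = (if (u, v) \<in> parcs G
     then 1 / sqrt (real (out_degree G u) * real (out_degree G v)) else 0)"

lemma randic_matrix_eq: "randic_matrix G vs = list_mat (randic_weight G) vs"
  by (simp add: randic_matrix_def list_mat_def randic_weight_def arcs_ends_def arc_to_ends_def)

text \<open>The rim vertices of each copy stand in path order, as the elimination of a cycle expects
  them at the head of the list.\<close>

definition rim :: "nat list \<Rightarrow> (nat \<times> nat) list" where
  "rim ks = concat (map (\<lambda>k. [(k, 1), (k, 2), (k, 3), (k, 4)]) ks)"

lemma rim_Cons: "rim (k # ks) = [(k, 1), (k, 2), (k, 3), (k, 4)] @ rim ks"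
  by (simp add: rim_def)

lemma set_rim: "set (rim ks) = set ks \<times> {1, 2, 3, 4}"
  by (auto simp: rim_def)

lemma distinct_rim: "distinct ks \<Longrightarrow> distinct (rim ks)"
proof (induction ks)
  case (Cons k ks)
  thus ?case by (auto simp: rim_Cons set_rim)
qed (simp add: rim_def)

text \<open>The hub has its own diagonal entry \<open>z\<close> because every eliminated cycle
  lowers it by \<open>r\<close>, while the rim entries stay \<open>x\<close>. The weights still come
  from the full graph, so \<open>n\<close> is fixed while \<open>ks\<close> shrinks.\<close>

lemma det_dutch_windmill:
  fixes x z :: real and n :: nat
  defines "r \<equiv> 2 * (1 / (4 * real n)) * (x - 1/2) / (x^2 - x/2 - 1/4)"
  assumes x: "x > 2" and ks: "distinct ks" "set ks \<subseteq> {..<n}"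
  shows "det (list_mat (\<lambda>u v. (if u = v then if u = (0, 0) then z else x else 0)
      - randic_weight (dutch_windmill 5 n) u v) (rim ks @ [(0, 0)])) =
    ((x^2 - x/2 - 1/4) * (x^2 + x/2 - 1/4)) ^ length ks * (z - real (length ks) * r)"
  using ks
proof (induction ks arbitrary: z)
  case Nil
  have "randic_weight (dutch_windmill 5 n) (0, 0) (0, 0) = 0"
    by (simp add: randic_weight_def parcs_dutch_windmill)
  thus ?case by (simp add: list_mat_def rim_def det_single)
next
  case (Cons k ks)
  let ?w = "randic_weight (dutch_windmill 5 n)"
  let ?F = "\<lambda>z u v. (if u = v then if u = (0, 0) then z else x else 0) - ?w u v"
  \<comment> \<open>A rim vertex has degree 2 and the hub degree \<open>2 * n\<close>.\<close>
  let ?g = "1 / sqrt (4 * real n)"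
  let ?p = "(x^2 - x/2 - 1/4) * (x^2 + x/2 - 1/4)"
  let ?r = "2 * ?g^2 * (x - 1/2) / (x^2 - x/2 - 1/4)"
  have r: "?r = r"
    by (simp add: r_def power_divide)
  have k: "k < n" "k \<notin> set ks" using Cons.prems by auto
  have arcs: "((k, i), v) \<in> parcs (dutch_windmill 5 n) \<longleftrightarrow>
      v \<in> (if i = 1 then {(0, 0), (k, 2)} else if i = 4 then {(k, 3), (0, 0)} else {(k, i - 1), (k, i + 1)})"
      "(v, (k, i)) \<in> parcs (dutch_windmill 5 n) \<longleftrightarrow>
      v \<in> (if i = 1 then {(0, 0), (k, 2)} else if i = 4 then {(k, 3), (0, 0)} else {(k, i - 1), (k, i + 1)})"
    if "i \<in> {1, 2, 3, 4}" for i v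
    using k that by (auto simp: parcs_dutch_windmill)
  note deg = out_degree_windmill_hub out_degree_windmill_rim[OF k(1)]
  note w = randic_weight_def arcs deg
  have "det (list_mat (?F z) ((k, 1) # (k, 2) # (k, 3) # (k, 4) # rim ks @ [(0, 0)])) =
    ?p * det (list_mat (\<lambda>u v. ?F z u v - (if u = (0, 0) \<and> v = (0, 0) then ?r else 0)) (rim ks @ [(0, 0)]))"
    using k by (intro det_list_mat_ear) (auto simp: w x set_rim)
  also have "list_mat (\<lambda>u v. ?F z u v - (if u = (0, 0) \<and> v = (0, 0) then ?r else 0)) (rim ks @ [(0, 0)])
    = list_mat (?F (z - r)) (rim ks @ [(0, 0)])"
    unfolding r by (rule list_mat_cong) auto
  also have "det \<dots> = ?p ^ length ks * (z - r - real (length ks) * r)"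
    by (rule Cons.IH) (use Cons.prems in auto)
  also have "?p * (?p ^ length ks * (z - r - real (length ks) * r)) =
    ?p ^ length (k # ks) * (z - real (length (k # ks)) * r)"
    by (simp only: length_Cons power_Suc of_nat_Suc distrib_right mult_1 mult.assoc diff_diff_eq)
  finally show ?case
    by (simp only: rim_Cons append_Cons append_Nil)
qed

lemma char_poly_randic_windmill:
  assumes n: "n > 0" and vs: "distinct vs" "set vs = pverts (dutch_windmill 5 n)"
  shows "char_poly (randic_matrix (dutch_windmill 5 n) vs) =
    [:-1, 1:] * [:-1/4, 1/2, 1:]^2 * ([:-1/4, -1/2, 1:] * [:-1/4, 1/2, 1:]) ^ (n - 1)"
    (is "?P = ?Q")
proof -
  let ?w = "randic_weight (dutch_windmill 5 n)"
  \<comment> \<open>Agreement on the infinite set \<open>x > 2\<close>, where no pivot vanishes,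
    determines the polynomial.\<close>
  have "poly ?P x = poly ?Q x" if x: "x > 2" for x
  proof -
    let ?q = "x^2 - x/2 - 1/4" and ?q' = "x^2 + x/2 - 1/4"
    have "x^2 > 2 * x" using x by (simp add: power2_eq_square)
    hence q: "?q \<noteq> 0" using x by linarith
    have "distinct (rim [0..<n] @ [(0, 0)])"
      by (auto simp: distinct_rim set_rim)
    moreover have "set vs = set (rim [0..<n] @ [(0, 0)])"
      using n by (auto simp: vs pverts_dutch_windmill set_rim)
    ultimately have mset: "mset vs = mset (rim [0..<n] @ [(0, 0)])"
      using vs(1) set_eq_iff_mset_eq_distinct by blast
    have "poly ?P x = det (list_mat (\<lambda>u v. (if u = v then x else 0) - ?w u v) vs)"
      using vs(1) by (simp add: randic_matrix_eq poly_char_poly_list_mat)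
    also have "\<dots> = det (list_mat (\<lambda>u v. (if u = v then x else 0) - ?w u v) (rim [0..<n] @ [(0, 0)]))"
      using mset by (rule det_list_mat_perm)
    also have "\<dots> = (?q * ?q') ^ n * (x - real n * (2 * (1 / (4 * real n)) * (x - 1/2) / ?q))"
      using det_dutch_windmill[OF x, of "[0..<n]" n x] by (simp add: atLeast0LessThan del: times_divide_eq_right cong del: if_weak_cong)
    also have "real n * (2 * (1 / (4 * real n)) * (x - 1/2) / ?q) = (x - 1/2) / (2 * ?q)"
      using n by simp
    \<comment> \<open>The numerator \<open>x * ?q - (x - 1/2) / 2\<close> factors as
      \<open>(x - 1) * ?q'\<close>. The denominator \<open>?q\<close> then cancels against one of
      the \<open>n\<close> cycle factors, which leaves the exponent \<open>n - 1\<close>.\<close>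
    also have "x - (x - 1/2) / (2 * ?q) = (x - 1) * ?q' / ?q"
      using q by (simp add: divide_simps) (simp add: algebra_simps power2_eq_square)
    also have "(?q * ?q') ^ n = ?q * ?q' * (?q * ?q') ^ (n - 1)"
      using n by (simp flip: power_Suc)
    also have "?q * ?q' * (?q * ?q') ^ (n - 1) * ((x - 1) * ?q' / ?q)
        = (x - 1) * ?q'^2 * (?q * ?q') ^ (n - 1)"
      using q by (simp add: power2_eq_square)
    also have "\<dots> = poly ?Q x"
    proof -
      have "poly [:-1/4, -1/2, 1:] x = ?q" "poly [:-1/4, 1/2, 1:] x = ?q'" "poly [:-1, 1:] x = x - 1"
        by (simp_all add: algebra_simps power2_eq_square)
      thus ?thesis by (simp only: poly_mult poly_power)
    qed
    finally show ?thesis .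
  qed
  hence "{2<..} \<subseteq> {x. poly (?P - ?Q) x = 0}" by auto
  moreover have "infinite {2 :: real<..}" by (rule infinite_Ioi)
  ultimately have "?P - ?Q = 0"
    using poly_roots_finite finite_subset by blast
  thus ?thesis by simp
qed

section \<open>Summing the absolute values of the roots\<close>

theorem theorem3p3:
  fixes n :: nat and vs :: "(nat \<times> nat) list"
  assumes "n > 0"
    and "distinct vs" and "set vs = pverts (dutch_windmill 5 n)"
  shows "randic_energy (dutch_windmill 5 n) vs = 1 + real n * sqrt 5"
proof -
  \<comment> \<open>The roots of the two quadratics are \<open>?a\<close>, \<open>- ?b\<close> and
    \<open>- ?a\<close>, \<open>?b\<close>; in both cases the absolute values add up to
    \<open>?a + ?b = sqrt 5 / 2\<close>.\<close>
  let ?a = "(1 + sqrt 5) / 4" and ?b = "(sqrt 5 - 1) / 4"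
  have factor: "[:-1/4, -1/2, 1:] = [:- ?a, 1:] * [:?b, 1:]" "[:-1/4, 1/2, 1:] = [:?a, 1:] * [:- ?b, 1:]"
    by (simp_all add: field_simps)
  have "1 \<le> sqrt (5::real)" by simp
  hence abs: "\<bar>?a\<bar> = ?a" "\<bar>?b\<bar> = ?b" "\<bar>- ?a\<bar> = ?a" "\<bar>- ?b\<bar> = ?b" by auto
  \<comment> \<open>Root multisets of nonzero polynomials add under multiplication, so
    \<open>S\<close> turns products into sums.\<close>
  define S :: "real poly \<Rightarrow> real" where "S p = (\<Sum>x\<in>#proots p. \<bar>x\<bar>)" for p
  have S_mult: "S (p * q) = S p + S q" if "p \<noteq> 0" "q \<noteq> 0" for p q
    using that by (simp add: S_def proots_mult)
  have S_power: "S (p ^ m) = real m * S p" if "p \<noteq> 0" for p m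
  proof (induction m)
    case (Suc m)
    thus ?case using that by (simp add: S_mult distrib_right)
  qed (simp add: S_def)
  have S_linear: "S [:c, 1:] = \<bar>c\<bar>" for c
    by (simp add: S_def)
  define q where "q = [:-1/4, -1/2, 1 :: real:]"
  define q' where "q' = [:-1/4, 1/2, 1 :: real:]"
  have "S q = \<bar>- ?a\<bar> + \<bar>?b\<bar>" "S q' = \<bar>?a\<bar> + \<bar>- ?b\<bar>"
    unfolding q_def q'_def factor
    by (simp_all add: S_mult S_linear del: mult_pCons_left mult_pCons_right abs_minus_cancel)
  hence S: "S q = sqrt 5 / 2" "S q' = sqrt 5 / 2"
    unfolding abs by (simp_all add: field_simps)
  have nz: "q \<noteq> 0" "q' \<noteq> 0" "[:-1, 1 :: real:] \<noteq> 0"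
    by (simp_all add: q_def q'_def)
  have "randic_energy (dutch_windmill 5 n) vs = S ([:-1, 1:] * q'^2 * (q * q') ^ (n - 1))"
    unfolding randic_energy_def char_poly_randic_windmill[OF assms] S_def q_def q'_def ..
  \<comment> \<open>The linear factor gives 1, the square of \<open>q'\<close> gives
    \<open>sqrt 5\<close>, and so does each of the \<open>n - 1\<close> factors
    \<open>q * q'\<close>.\<close>
  also have "\<dots> = 1 + sqrt 5 + real (n - 1) * sqrt 5"
    using nz by (simp add: S_mult S_power S_linear S del: mult_pCons_left mult_pCons_right)
  finally have "randic_energy (dutch_windmill 5 n) vs = 1 + sqrt 5 + real (n - 1) * sqrt 5" .
  thus ?thesis
    using assms(1) by (simp add: of_nat_diff algebra_simps)
qed

end
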